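(* Let $F=F(x_1,\dots,x_r)\in\mathbb{C}[x_1,\dots,x_r]$ be a smooth homogeneous polynomial of degree $d\ge 3$, where $r\ge 2$. Fix positive integers $r_1,\dots,r_m$ with $\sum_{1\le i\le m}r_i=r$, where $1\le m\le r$. Let $N\subset\mathrm{Aut}(F)$ be an abelian subgroup generated by matrices of the form $\mathrm{diag}(\lambda_1I_{r_1},\lambda_2I_{r_2},\dots,\lambda_mI_{r_m})$ with $\lambda_i\in\mathbb{C}^\times$. Then $|N|\le d^m$.
   Context: A homogeneous polynomial $F\in\mathbb{C}[x_1,\dots,x_r]$ is smooth if $(0,\ldots,0)$ is the only common zero of $\partial F/\partial x_1,\ldots,\partial F/\partial x_r$. For $A=(a_{ij})\in\mathrm{GL}(r,\mathbb{C})$ put $A(F)=F(\sum_i a_{1i}x_i,\ldots,\sum_i a_{ri}x_i)$, and $\mathrm{Aut}(F)=\{A\in\mathrm{GL}(r,\mathbb{C})\mid A(F)=F\}$. $I_k$ is the $k\times k$ identity matrix. *)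

theory Defs
  imports
    "HOL-Library.Poly_Mapping"
    "HOL-Algebra.Generated_Groups"
    "Jordan_Normal_Form.Matrix"
begin

text \<open>A monomial is its exponent vector, and a polynomial maps each monomial to its coefficient.
  The variables x_1, ..., x_r have the indices 0, ..., r - 1; that no other
  variable occurs is expressed by \<open>polys_in r\<close>. The library product on this type is the usual
  (convolution) product of polynomials.\<close>

type_synonym cpoly = "(nat \<Rightarrow>\<^sub>0 nat) \<Rightarrow>\<^sub>0 complex"

definition polys_in :: "nat \<Rightarrow> cpoly set" where
  "polys_in r = {F. \<forall>m \<in> Poly_Mapping.keys F. Poly_Mapping.keys m \<subseteq> {..<r}}"

definition homogeneous_of_degree :: "nat \<Rightarrow> cpoly \<Rightarrow> bool" where
  "homogeneous_of_degree d F \<longleftrightarrow>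
     (\<forall>m \<in> Poly_Mapping.keys F. (\<Sum>i \<in> Poly_Mapping.keys m. Poly_Mapping.lookup m i) = d)"

text \<open>For a ring homomorphism \<open>c\<close>, the ring homomorphism that sends coefficients along \<open>c\<close> and the
  variable with index \<open>i\<close> to \<open>s i\<close>. It serves both for evaluation at a point and for the
  substitution of polynomials for the variables.\<close>

definition insertion_along :: "(complex \<Rightarrow> 'b) \<Rightarrow> (nat \<Rightarrow> 'b) \<Rightarrow> cpoly \<Rightarrow> 'b::comm_semiring_1" where
  "insertion_along c s F =
     (\<Sum>m \<in> Poly_Mapping.keys F. c (Poly_Mapping.lookup F m) *
        (\<Prod>i \<in> Poly_Mapping.keys m. s i ^ Poly_Mapping.lookup m i))"

definition eval_at :: "complex vec \<Rightarrow> cpoly \<Rightarrow> complex" where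
  "eval_at v F = insertion_along (\<lambda>c. c) (\<lambda>i. v $ i) F"

definition const_poly :: "complex \<Rightarrow> cpoly" where
  "const_poly c = Poly_Mapping.single 0 c"

definition var_poly :: "nat \<Rightarrow> cpoly" where
  "var_poly i = Poly_Mapping.single (Poly_Mapping.single i 1) 1"

text \<open>Termwise formal derivative. Subtraction of exponents truncates, which is harmless:
  a monomial not containing the variable contributes with coefficient 0.\<close>

definition partial_deriv :: "nat \<Rightarrow> cpoly \<Rightarrow> cpoly" where
  "partial_deriv i F =
     (\<Sum>m \<in> Poly_Mapping.keys F.
        Poly_Mapping.single (m - Poly_Mapping.single i 1)
          (of_nat (Poly_Mapping.lookup m i) * Poly_Mapping.lookup F m))"

definition smooth_poly :: "nat \<Rightarrow> cpoly \<Rightarrow> bool" where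
  "smooth_poly r F \<longleftrightarrow>
     {v \<in> carrier_vec r. \<forall>i<r. eval_at v (partial_deriv i F) = 0} = {0\<^sub>v r}"

definition GL :: "nat \<Rightarrow> complex mat monoid" where
  "GL r = units_of (ring_mat TYPE(complex) r ())"

text \<open>Substitutes the linear form given by row \<open>j\<close> of \<open>A\<close> for the variable with index \<open>j\<close>.\<close>

definition mat_act :: "nat \<Rightarrow> complex mat \<Rightarrow> cpoly \<Rightarrow> cpoly" where
  "mat_act r A F =
     insertion_along const_poly (\<lambda>j. \<Sum>i<r. const_poly (A $$ (j, i)) * var_poly i) F"

definition Aut :: "nat \<Rightarrow> cpoly \<Rightarrow> complex mat set" where
  "Aut r F = {A \<in> carrier (GL r). mat_act r A F = F}"

definition block_scalar_mats :: "nat list \<Rightarrow> complex mat set" where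
  "block_scalar_mats rs =
     {diag_block_mat (map2 (\<lambda>l k. l \<cdot>\<^sub>m 1\<^sub>m k) ls rs) | ls. length ls = length rs \<and> 0 \<notin> set ls}"

lemma group_GL: "group (GL r)"
proof -
  interpret ring "ring_mat TYPE(complex) r ()" by (rule ring_mat)
  show ?thesis unfolding GL_def by (rule units_group)
qed

lemma carrier_GL: "carrier (GL r) = {A \<in> carrier_mat r r. invertible_mat A}"
proof -
  have "\<exists>B\<in>carrier_mat r r. B * A = 1\<^sub>m r \<and> A * B = 1\<^sub>m r"
    if A: "A \<in> carrier_mat r r" and inv: "A * B = 1\<^sub>m (dim_row A)" "B * A = 1\<^sub>m (dim_row B)"
    for A B :: "complex mat"
  proof -
    have "dim_col B = r"
      using arg_cong[OF inv(1), of dim_col] A by simp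
    moreover have "dim_row B = r"
      using arg_cong[OF inv(2), of dim_col] A by simp
    ultimately have "B \<in> carrier_mat r r" by auto
    then show ?thesis using inv A by auto
  qed
  then show ?thesis
    unfolding GL_def units_of_carrier Units_def ring_mat_simps invertible_mat_def inverts_mat_def
    by (auto 0 4)
qed

end

theory Submission
  imports Defs "HOL-Computational_Algebra.Polynomial"
begin

text \<open>Smoothness at the \<open>i\<close>-th unit vector forces a monomial \<open>x\<^sub>i\<^sup>d\<^sup>-\<^sup>1 x\<^sub>j\<close> into \<open>F\<close>. Choosing one row
  \<open>i\<close> in each block \<open>a\<close>, and writing \<open>f a\<close> for the block of the corresponding \<open>j\<close>, the scalars of
  every element of \<open>N\<close> satisfy \<open>\<lambda>\<^sub>a\<^sup>d\<^sup>-\<^sup>1 \<lambda>\<^bsub>f a\<^esub> = 1\<close> for all \<open>m\<close> blocks. Such a system has at most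
  \<open>d\<^sup>m\<close> solutions: a block outside the image of \<open>f\<close> contributes at most \<open>d - 1\<close> choices once the
  others are fixed, and if \<open>f\<close> is a permutation, the scalars on a cycle of length \<open>k\<close> are
  determined by a single one, which is a root of unity of order dividing \<open>(d - 1)\<^sup>k \<plusminus> 1\<close>; this is
  at most \<open>d\<^sup>k\<close>, and it is positive because \<open>d \<ge> 3\<close>.\<close>

section \<open>Multiplicative systems along a self-map\<close>

lemma finite_card_roots_le:
  fixes c :: "'a::idom"
  assumes "n > 0"
  shows "finite {x. x ^ n = c}" and "card {x. x ^ n = c} \<le> n"
proof -
  let ?p = "monom 1 n - [:c:]"
  have "coeff ?p n = 1"
    using assms by (simp add: coeff_pCons split: nat.split)
  then have "?p \<noteq> 0" by (metis coeff_0 zero_neq_one)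
  moreover have roots: "{x. poly ?p x = 0} = {x. x ^ n = c}"
    by (simp add: poly_monom)
  moreover have "degree ?p \<le> n"
    by (rule degree_diff_le) (auto simp: degree_monom_le)
  ultimately show "finite {x. x ^ n = c}" "card {x. x ^ n = c} \<le> n"
    using poly_roots_finite[of ?p] card_poly_roots_bound[of ?p] by simp_all
qed

text \<open>Controls the exponent \<open>n ^ k + 1\<close> that cycles of odd length produce. At
  \<open>k = 0\<close> the inequality would fail.\<close>

lemma Suc_power_le_power_Suc:
  fixes n k :: nat
  assumes "k > 0"
  shows "n ^ k + 1 \<le> (n + 1) ^ k"
  using assms
proof (induction k rule: nat_induct_non_zero)
  case (Suc k)
  have "n ^ Suc k + 1 \<le> (n + 1) * (n ^ k + 1)" by simp
  also have "\<dots> \<le> (n + 1) * (n + 1) ^ k" using Suc.IH by (rule mult_le_mono2)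
  finally show ?case by simp
qed simp

text \<open>Solutions are extensional, so that each one is counted once by its values on
  \<open>A\<close>. For \<open>n > 0\<close> the equations force these values to be nonzero.\<close>

definition power_system :: "nat \<Rightarrow> ('i \<Rightarrow> 'i) \<Rightarrow> 'i set \<Rightarrow> ('i \<Rightarrow> 'a::field) set" where
  "power_system n f A = {l \<in> A \<rightarrow>\<^sub>E UNIV. \<forall>a\<in>A. l a ^ n * l (f a) = 1}"

lemma power_system_restrict:
  assumes "l \<in> power_system n f A" and "B \<subseteq> A" and "f ` B \<subseteq> B"
  shows "restrict l B \<in> power_system n f B"
  using assms by (auto simp: power_system_def image_subset_iff subset_iff)

text \<open>Each equation says that passing from \<open>x\<close> to \<open>f x\<close> raises the
  value to the power -n. So \<open>l a\<close> determines \<open>l\<close> on the whole orbit, and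
  one full turn equates \<open>l a\<close> with its own power of exponent (-n)^k.\<close>

lemma card_power_system_cycle:
  fixes f :: "'i \<Rightarrow> 'i" and a :: 'i
  defines "C \<equiv> \<lambda>k. (\<lambda>i. (f ^^ i) a) ` {..<k}"
  assumes n: "n \<ge> 2" and k: "k > 0" and cyc: "(f ^^ k) a = a"
  shows "finite (power_system n f (C k) :: ('i \<Rightarrow> 'a::field) set)"
    and "card (power_system n f (C k) :: ('i \<Rightarrow> 'a) set) \<le> (n + 1) ^ k"
proof -
  define S where "S = (power_system n f (C k) :: ('i \<Rightarrow> 'a) set)"
  \<comment> \<open>The absolute value of (-n)^k - 1, the exponent left after cancelling
    \<open>l a\<close> once around the cycle.\<close>
  define q where "q = (if even k then n ^ k - 1 else n ^ k + 1)"
  \<comment> \<open>For \<open>n = 1\<close> and even \<open>k\<close> the exponent \<open>q\<close>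
    would be 0 and the root condition vacuous.\<close>
  have nk: "n ^ k \<ge> 2"
    using n k self_le_power[of n k] by linarith
  then have q: "q > 0" by (simp add: q_def)
  \<comment> \<open>The exponent (-n)^i is split by parity to stay within natural exponents. The
    range includes \<open>i = k\<close>, one past the indices of the orbit, in order to close the
    cycle.\<close>
  have iter: "l ((f ^^ i) a) = (if even i then l a ^ (n ^ i) else inverse (l a ^ (n ^ i)))"
    if "l \<in> S" "i \<le> k" for l i
    using that(2)
  proof (induction i)
    case (Suc i)
    have "l ((f ^^ i) a) ^ n * l (f ((f ^^ i) a)) = 1"
      using that(1) Suc.prems by (auto simp: S_def power_system_def C_def)
    then have "l ((f ^^ Suc i) a) = inverse (l ((f ^^ i) a) ^ n)"
      by (metis funpow.simps(2) comp_apply inverse_unique)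
    then show ?case
      using Suc by (simp add: power_inverse power_mult[symmetric] mult.commute)
  qed simp
  have "(\<lambda>l. l a) ` S \<subseteq> {x. x ^ q = 1}"
  proof safe
    fix l assume l: "l \<in> S"
    have "a \<in> C k" using k by (force simp: C_def intro: image_eqI[of _ _ 0])
    then have "l a ^ n * l (f a) = 1"
      using l by (auto simp: S_def power_system_def)
    then have "l a \<noteq> 0"
      using n by (auto simp: power_0_left)
    moreover have "l a = (if even k then l a ^ (n ^ k) else inverse (l a ^ (n ^ k)))"
      using iter[OF l, of k] cyc by simp
    ultimately show "l a ^ q = 1"
      using nk by (auto simp: q_def power_diff field_simps split: if_splits)
  qed
  moreover have inj: "inj_on (\<lambda>l. l a) S"
  proof (rule inj_onI)
    fix l l' assume l: "l \<in> S" "l' \<in> S" and eq: "l a = l' a"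
    show "l = l'"
    proof (rule PiE_ext)
      show "l \<in> C k \<rightarrow>\<^sub>E UNIV" "l' \<in> C k \<rightarrow>\<^sub>E UNIV"
        using l by (auto simp: S_def power_system_def)
      fix x assume "x \<in> C k"
      then show "l x = l' x"
        using iter[OF l(1)] iter[OF l(2)] eq by (auto simp: C_def)
    qed
  qed
  ultimately have "finite S" "card S \<le> card {x::'a. x ^ q = 1}"
    using finite_card_roots_le(1)[OF q] by (blast intro: inj_on_finite card_inj_on_le)+
  moreover have "card {x::'a. x ^ q = 1} \<le> q"
    by (rule finite_card_roots_le(2)[OF q])
  moreover have "q \<le> (n + 1) ^ k"
    using Suc_power_le_power_Suc[OF k, of n] by (auto simp: q_def)
  ultimately show "finite (power_system n f (C k) :: ('i \<Rightarrow> 'a) set)"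
    "card (power_system n f (C k) :: ('i \<Rightarrow> 'a) set) \<le> (n + 1) ^ k"
    by (auto simp: S_def)
qed

text \<open>Since nothing in \<open>A\<close> maps to \<open>a\<close>, the unknown
  \<open>l a\<close> occurs only in its own equation. The other equations form a system on
  \<open>A - {a}\<close>, and \<open>f a\<close> lies in that set.\<close>

lemma power_system_Diff_singleton_subset:
  fixes f :: "'i \<Rightarrow> 'i"
  assumes "f ` A \<subseteq> A" and "a \<in> A" and "a \<notin> f ` A"
  shows "(power_system n f A :: ('i \<Rightarrow> 'a::field) set)
    \<subseteq> (\<Union>l \<in> power_system n f (A - {a}). (\<lambda>x. l(a := x)) ` {x. x ^ n = inverse (l (f a))})"
proof
  fix l :: "'i \<Rightarrow> 'a" assume l: "l \<in> power_system n f A"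
  let ?l = "restrict l (A - {a})"
  have "?l \<in> power_system n f (A - {a})"
    using l assms by (intro power_system_restrict) auto
  moreover have "?l(a := l a) = l"
    using l assms(2) by (auto simp: power_system_def fun_eq_iff PiE_def extensional_def)
  moreover have "l a ^ n = inverse (?l (f a))"
  proof -
    have "l a ^ n * l (f a) = 1"
      using l assms(2) by (auto simp: power_system_def)
    then have "l a ^ n = inverse (l (f a))"
      by (metis inverse_unique mult.commute)
    moreover have "f a \<in> A - {a}"
      using assms by (metis Diff_iff image_eqI image_subset_iff singletonD)
    ultimately show ?thesis by simp
  qed
  ultimately show "l \<in> (\<Union>l \<in> power_system n f (A - {a}).
      (\<lambda>x. l(a := x)) ` {x. x ^ n = inverse (l (f a))})"
    by (intro UN_I[of ?l]) (auto intro!: image_eqI[of _ _ "l a"])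
qed

text \<open>By pigeonhole two iterates of \<open>a\<close> collide, and injectivity cancels their
  common steps, so the orbit returns to \<open>a\<close> itself. The least period makes the earlier
  iterates distinct.\<close>

lemma inj_on_finite_cycle:
  fixes f :: "'i \<Rightarrow> 'i"
  assumes "finite A" and "f ` A \<subseteq> A" and "inj_on f A" and "a \<in> A"
  obtains k where "k > 0" and "(f ^^ k) a = a" and "inj_on (\<lambda>i. (f ^^ i) a) {..<k}"
proof -
  have mem: "(f ^^ i) a \<in> A" for i
    using assms by (induction i) auto
  have cancel: "(f ^^ (j - i)) a = a" if "(f ^^ i) a = (f ^^ j) a" "i \<le> j" for i j
    using that
  proof (induction i arbitrary: j)
    case (Suc i)
    then obtain j' where "j = Suc j'" by (cases j) auto
    then show ?case using Suc mem assms(3) by (auto dest: inj_onD)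
  qed simp
  have "\<not> inj (\<lambda>i. (f ^^ i) a)"
    using mem assms(1) by (metis finite_subset image_subsetI infinite_UNIV_nat finite_imageD)
  then obtain i j where ij: "i < j" "(f ^^ i) a = (f ^^ j) a"
    by (metis (mono_tags, lifting) injI nat_neq_iff)
  define k where "k = (LEAST k. k > 0 \<and> (f ^^ k) a = a)"
  have "j - i > 0 \<and> (f ^^ (j - i)) a = a"
    using cancel[OF ij(2)] ij(1) by auto
  then have k: "k > 0 \<and> (f ^^ k) a = a"
    unfolding k_def by (rule LeastI)
  have "inj_on (\<lambda>i. (f ^^ i) a) {..<k}"
  proof (rule linorder_inj_onI)
    fix i j assume ij: "i < j" "i \<in> {..<k}" "j \<in> {..<k}"
    show "(f ^^ i) a \<noteq> (f ^^ j) a"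
    proof
      assume "(f ^^ i) a = (f ^^ j) a"
      then have "j - i > 0 \<and> (f ^^ (j - i)) a = a" using cancel ij by auto
      then have "k \<le> j - i" unfolding k_def by (rule Least_le)
      then show False using ij k by auto
    qed
  qed auto
  then show ?thesis using k that by blast
qed

lemma card_power_system_le:
  fixes f :: "'i \<Rightarrow> 'i"
  assumes "finite A" and "f ` A \<subseteq> A" and n: "n \<ge> 2"
  shows "finite (power_system n f A :: ('i \<Rightarrow> 'a::field) set)
    \<and> card (power_system n f A :: ('i \<Rightarrow> 'a) set) \<le> (n + 1) ^ card A"
  using assms(1,2)
proof (induction A rule: finite_psubset_induct)
  case (psubset A)
  let ?S = "\<lambda>B. power_system n f B :: ('i \<Rightarrow> 'a) set"
  consider "A = {}" | a where "a \<in> A" "a \<notin> f ` A" | a where "a \<in> A" "f ` A = A"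
    using psubset.prems by blast
  then show ?case
  proof cases
    case 1
    then have "?S A = {\<lambda>_. undefined}" by (auto simp: power_system_def)
    then show ?thesis using 1 by simp
  next
    case 2
    let ?E = "\<lambda>l. (\<lambda>x. l(a := x)) ` {x. x ^ n = inverse (l (f a))}"
    have IH: "finite (?S (A - {a}))" "card (?S (A - {a})) \<le> (n + 1) ^ card (A - {a})"
      using psubset.IH[of "A - {a}"] psubset.prems 2 by auto
    have roots: "finite {x::'a. x ^ n = c}" "card {x::'a. x ^ n = c} \<le> n" for c
      using finite_card_roots_le[of n c] n by auto
    have E: "finite (?E l)" "card (?E l) \<le> n" for l :: "'i \<Rightarrow> 'a"
      using roots by (auto intro: le_trans[OF card_image_le])
    have sub: "?S A \<subseteq> (\<Union>l \<in> ?S (A - {a}). ?E l)"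
      using power_system_Diff_singleton_subset[OF psubset.prems 2] .
    have fin: "finite (\<Union>l \<in> ?S (A - {a}). ?E l)"
      using IH(1) E(1) by blast
    have "card (?S A) \<le> card (\<Union>l \<in> ?S (A - {a}). ?E l)"
      using sub fin by (rule card_mono[rotated])
    also have "\<dots> \<le> (\<Sum>l \<in> ?S (A - {a}). card (?E l))"
      by (rule card_UN_le[OF IH(1)])
    also have "\<dots> \<le> card (?S (A - {a})) * n"
      using sum_bounded_above[of "?S (A - {a})" "\<lambda>l. card (?E l)" n] E(2) by simp
    \<comment> \<open>The bound \<open>n\<close> on the choices for \<open>l a\<close> is relaxed to
      \<open>n + 1\<close>, the bound for a fixed point of \<open>f\<close>.\<close>
    also have "\<dots> \<le> (n + 1) ^ card (A - {a}) * (n + 1)"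
      using IH(2) by (intro mult_le_mono) auto
    also have "\<dots> = (n + 1) ^ card A"
      using psubset.hyps 2(1) by (metis card.remove power_Suc mult.commute)
    finally show ?thesis using finite_subset[OF sub fin] by blast
  next
    case 3
    have inj: "inj_on f A"
      using psubset.hyps 3 by (simp add: eq_card_imp_inj_on)
    obtain k where k: "k > 0" "(f ^^ k) a = a" "inj_on (\<lambda>i. (f ^^ i) a) {..<k}"
      using inj_on_finite_cycle[OF psubset.hyps psubset.prems inj 3(1)] .
    define C where "C = (\<lambda>i. (f ^^ i) a) ` {..<k}"
    have card_C: "card C = k" using k(3) by (simp add: C_def card_image)
    have "(f ^^ i) a \<in> A" for i using 3 by (induction i) auto
    then have C: "C \<subseteq> A" "a \<in> C"
      using k(1) by (auto simp: C_def intro: image_eqI[of _ _ 0])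
    have shift: "f ((f ^^ i) a) \<in> C" if "i < k" for i
    proof (cases "Suc i = k")
      case True
      then show ?thesis using k(2) C(2) by auto
    next
      case False
      then show ?thesis using that unfolding C_def by (intro image_eqI[of _ _ "Suc i"]) auto
    qed
    then have fC: "f ` C \<subseteq> C" by (auto simp: C_def)
    have "finite C" by (simp add: C_def)
    \<comment> \<open>As \<open>f\<close> is injective on \<open>A\<close> and already covers
      \<open>C\<close> from within, no element outside \<open>C\<close> maps into it. The system
      therefore splits into independent systems on \<open>C\<close> and
      \<open>A - C\<close>.\<close>
    then have "f ` C = C"
      using fC inj C(1) by (meson endo_inj_surj inj_on_subset)
    then have fD: "f ` (A - C) \<subseteq> A - C"
      using 3(2) C(1) inj by (simp add: inj_on_image_set_diff)
    have IH: "finite (?S (A - C))" "card (?S (A - C)) \<le> (n + 1) ^ card (A - C)"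
      using psubset.IH[of "A - C"] fD C 3(1) by blast+
    have cyc: "finite (?S C)" "card (?S C) \<le> (n + 1) ^ card C"
      using card_power_system_cycle[OF n k(1,2)] card_C by (auto simp: C_def)
    let ?r = "\<lambda>l. (restrict l C, restrict l (A - C))"
    have "inj_on ?r (?S A)"
    proof (rule inj_onI)
      fix l l' assume l: "l \<in> ?S A" "l' \<in> ?S A" and eq: "?r l = ?r l'"
      show "l = l'"
      proof (rule PiE_ext)
        show "l \<in> A \<rightarrow>\<^sub>E UNIV" "l' \<in> A \<rightarrow>\<^sub>E UNIV"
          using l by (auto simp: power_system_def)
        fix x assume "x \<in> A"
        then show "l x = l' x"
          using eq by (metis Diff_iff Pair_inject restrict_apply')
      qed
    qed
    moreover have "?r ` ?S A \<subseteq> ?S C \<times> ?S (A - C)"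
      using power_system_restrict fC fD C(1) by fastforce
    moreover have fin: "finite (?S C \<times> ?S (A - C))"
      using IH(1) cyc(1) by simp
    ultimately have "finite (?S A)" "card (?S A) \<le> card (?S C \<times> ?S (A - C))"
      by (auto intro: inj_on_finite card_inj_on_le)
    moreover have "card (?S C \<times> ?S (A - C)) \<le> (n + 1) ^ card C * (n + 1) ^ card (A - C)"
      using IH(2) cyc(2) by (simp add: card_cartesian_product mult_le_mono)
    moreover have "(n + 1) ^ card C * (n + 1) ^ card (A - C) = (n + 1) ^ card A"
      using psubset.hyps C(1) \<open>finite C\<close>
      by (simp add: power_add[symmetric] card_Diff_subset card_mono)
    ultimately show ?thesis by linarith
  qed
qed

section \<open>Monomials forced by smoothness\<close>

text \<open>Some partial derivative is nonzero at the unit vector of index \<open>i\<close>.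
  Evaluation there kills every monomial containing another variable, so this derivative contains a
  pure power of the \<open>i\<close>-th variable; undoing the differentiation and comparing degrees
  gives the monomial.\<close>

lemma smooth_poly_monomial:
  assumes F: "F \<in> polys_in r" "homogeneous_of_degree d F" "smooth_poly r F" and i: "i < r"
  obtains j where "j < r"
    and "Poly_Mapping.single i (d - 1) + Poly_Mapping.single j 1 \<in> Poly_Mapping.keys F"
proof -
  let ?v = "unit_vec r i :: complex vec"
  have "?v \<notin> {0\<^sub>v r}"
    using i by (metis index_unit_vec(2) index_zero_vec(1) singletonD zero_neq_one)
  then have "?v \<notin> {v \<in> carrier_vec r. \<forall>i<r. eval_at v (partial_deriv i F) = 0}"
    using F(3) unfolding smooth_poly_def by metis
  then obtain j where j: "j < r" "eval_at ?v (partial_deriv j F) \<noteq> 0" by auto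
  let ?x = "Poly_Mapping.single j (1::nat)"
  obtain p where p: "p \<in> Poly_Mapping.keys (partial_deriv j F)"
    "(\<Prod>k \<in> Poly_Mapping.keys p. ?v $ k ^ Poly_Mapping.lookup p k) \<noteq> 0"
    using j(2) unfolding eval_at_def insertion_along_def
    by (metis (no_types, lifting) mult_zero_right sum.neutral)
  \<comment> \<open>A monomial of \<open>F\<close> whose derivative contributes to \<open>p\<close>.
    Its positive exponent at \<open>j\<close> rules out truncation, so that \<open>q\<close> can be
    recovered from \<open>p\<close>.\<close>
  obtain q where q: "q \<in> Poly_Mapping.keys F" "p = q - ?x" "Poly_Mapping.lookup q j \<noteq> 0"
  proof -
    have "Poly_Mapping.lookup (partial_deriv j F) p \<noteq> 0"
      using p(1) by (simp add: in_keys_iff)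
    then obtain q where "q \<in> Poly_Mapping.keys F"
      "Poly_Mapping.lookup (Poly_Mapping.single (q - ?x)
        (of_nat (Poly_Mapping.lookup q j) * Poly_Mapping.lookup F q)) p \<noteq> 0"
      unfolding partial_deriv_def lookup_sum by (meson sum.not_neutral_contains_not_neutral)
    then show ?thesis
      using that by (auto simp: lookup_single when_def split: if_splits)
  qed
  have qp: "q = p + ?x"
    using q(2,3) by (intro poly_mapping_eqI) (auto simp: lookup_add lookup_minus lookup_single when_def)
  have "Poly_Mapping.keys p \<subseteq> Poly_Mapping.keys q"
    using qp by (auto simp: in_keys_iff lookup_add)
  then have kr: "Poly_Mapping.keys p \<subseteq> {..<r}"
    using F(1) q(1) unfolding polys_in_def by blast
  have "Poly_Mapping.keys p \<subseteq> {i}"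
  proof
    fix k assume k: "k \<in> Poly_Mapping.keys p"
    then have "?v $ k ^ Poly_Mapping.lookup p k \<noteq> 0"
      using p(2) by auto
    moreover have "Poly_Mapping.lookup p k > 0" using k by (simp add: in_keys_iff)
    ultimately show "k \<in> {i}" using k kr i by (auto simp: subset_iff split: if_splits)
  qed
  then have "Poly_Mapping.lookup p k = 0" if "k \<noteq> i" for k
    using that by (metis in_keys_iff singletonD subsetD)
  then have ps: "p = Poly_Mapping.single i (Poly_Mapping.lookup p i)"
    by (intro poly_mapping_eqI) (auto simp: lookup_single when_def)
  define c where "c = Poly_Mapping.lookup p i"
  have qc: "q = Poly_Mapping.single i c + ?x" using qp ps c_def by simp
  have "(\<Sum>k \<in> Poly_Mapping.keys q. Poly_Mapping.lookup q k) = d"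
    using F(2) q(1) unfolding homogeneous_of_degree_def by blast
  moreover have "(\<Sum>k \<in> Poly_Mapping.keys q. Poly_Mapping.lookup q k)
      = (\<Sum>k \<in> {i, j}. Poly_Mapping.lookup q k)"
    by (rule sum.mono_neutral_left)
      (auto simp: in_keys_iff qc lookup_add lookup_single when_def split: if_splits)
  moreover have "\<dots> = c + 1"
    by (cases "i = j") (auto simp: qc lookup_add lookup_single when_def)
  ultimately show ?thesis using that j(1) q(1) qc by auto
qed

section \<open>Diagonal substitutions\<close>

lemma single_single_power:
  "Poly_Mapping.single (Poly_Mapping.single i (1::nat)) (c::'a::comm_semiring_1) ^ n
    = Poly_Mapping.single (Poly_Mapping.single i n) (c ^ n)"
  by (induction n) (simp_all add: mult_single single_add[symmetric])

lemma prod_single: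
  "(\<Prod>i\<in>I. Poly_Mapping.single (k i :: 'k::comm_monoid_add) (c i :: 'a::comm_semiring_1))
    = Poly_Mapping.single (\<Sum>i\<in>I. k i) (\<Prod>i\<in>I. c i)"
  by (induction I rule: infinite_finite_induct) (simp_all add: mult_single)

lemma sum_single_keys:
  "(\<Sum>i \<in> Poly_Mapping.keys p. Poly_Mapping.single i (Poly_Mapping.lookup p i)) = p"
  by (intro poly_mapping_eqI)
    (simp add: lookup_sum lookup_single when_def in_keys_iff)

text \<open>Each variable is replaced by a multiple of itself, so monomials never mix and only their
  coefficients are rescaled.\<close>

lemma mat_act_mat_diag:
  assumes "F \<in> polys_in r"
  shows "mat_act r (mat_diag r g) F =
    (\<Sum>p \<in> Poly_Mapping.keys F. Poly_Mapping.single p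
      (Poly_Mapping.lookup F p * (\<Prod>i \<in> Poly_Mapping.keys p. g i ^ Poly_Mapping.lookup p i)))"
  unfolding mat_act_def insertion_along_def
proof (rule sum.cong[OF refl])
  fix p assume p: "p \<in> Poly_Mapping.keys F"
  let ?row = "\<lambda>j. \<Sum>i<r. const_poly (mat_diag r g $$ (j, i)) * var_poly i"
  have row: "?row j = Poly_Mapping.single (Poly_Mapping.single j 1) (g j)" if "j < r" for j
  proof -
    have "?row j = (\<Sum>i<r. if i = j then Poly_Mapping.single (Poly_Mapping.single j 1) (g j) else 0)"
      using that
      by (intro sum.cong) (auto simp: mat_diag_def const_poly_def var_poly_def mult_single)
    then show ?thesis using that by simp
  qed
  have "(\<Prod>j \<in> Poly_Mapping.keys p. ?row j ^ Poly_Mapping.lookup p j)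
    = (\<Prod>j \<in> Poly_Mapping.keys p. Poly_Mapping.single
        (Poly_Mapping.single j (Poly_Mapping.lookup p j)) (g j ^ Poly_Mapping.lookup p j))"
    using assms p
    by (intro prod.cong) (auto simp: polys_in_def row single_single_power[symmetric] subset_iff)
  also have "\<dots> = Poly_Mapping.single p (\<Prod>j \<in> Poly_Mapping.keys p. g j ^ Poly_Mapping.lookup p j)"
    by (simp add: prod_single sum_single_keys)
  finally show "const_poly (Poly_Mapping.lookup F p) *
      (\<Prod>j \<in> Poly_Mapping.keys p. ?row j ^ Poly_Mapping.lookup p j)
    = Poly_Mapping.single p (Poly_Mapping.lookup F p *
      (\<Prod>j \<in> Poly_Mapping.keys p. g j ^ Poly_Mapping.lookup p j))"
    by (simp add: const_poly_def mult_single)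
qed

text \<open>The coefficient of \<open>F\<close> at \<open>p\<close> is nonzero and cancels when
  coefficients are compared.\<close>

lemma mat_diag_fixes_monomial:
  assumes "F \<in> polys_in r" and "mat_act r (mat_diag r g) F = F" and p: "p \<in> Poly_Mapping.keys F"
  shows "(\<Prod>i \<in> Poly_Mapping.keys p. g i ^ Poly_Mapping.lookup p i) = 1"
proof -
  have "Poly_Mapping.lookup F p = Poly_Mapping.lookup (mat_act r (mat_diag r g) F) p"
    using assms(2) by simp
  also have "\<dots> = Poly_Mapping.lookup F p *
      (\<Prod>i \<in> Poly_Mapping.keys p. g i ^ Poly_Mapping.lookup p i)"
    using p by (simp add: mat_act_mat_diag[OF assms(1)] lookup_sum lookup_single when_def)
  finally show ?thesis using p by (simp add: in_keys_iff)
qed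

lemma prod_keys_two_variables:
  fixes g :: "'i \<Rightarrow> 'a::comm_semiring_1"
  defines "p \<equiv> \<lambda>i j n. Poly_Mapping.single i n + Poly_Mapping.single j (1::nat)"
  shows "(\<Prod>k \<in> Poly_Mapping.keys (p i j n). g k ^ Poly_Mapping.lookup (p i j n) k) = g i ^ n * g j"
proof -
  \<comment> \<open>For \<open>n = 0\<close> the index \<open>i\<close> need not be a key; it then
    enters with exponent 0. For \<open>i = j\<close> both exponents add up at a single key.\<close>
  have "(\<Prod>k \<in> Poly_Mapping.keys (p i j n). g k ^ Poly_Mapping.lookup (p i j n) k)
      = (\<Prod>k \<in> {i, j}. g k ^ Poly_Mapping.lookup (p i j n) k)"
    by (rule prod.mono_neutral_left)
      (auto simp: in_keys_iff p_def lookup_add lookup_single when_def split: if_splits)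
  also have "\<dots> = g i ^ n * g j"
    by (cases "i = j") (auto simp: p_def lookup_add lookup_single when_def mult.commute)
  finally show ?thesis .
qed

section \<open>Block scalar matrices\<close>

text \<open>Entry \<open>i\<close> is the index of the block that contains row \<open>i\<close>.\<close>

definition block_indices :: "nat list \<Rightarrow> nat list" where
  "block_indices rs = concat (map2 (\<lambda>a k. replicate k a) [0..<length rs] rs)"

lemma length_block_indices: "length (block_indices rs) = sum_list rs"
proof -
  have "map length (map2 (\<lambda>a k. replicate k a) [0..<length rs] rs) = rs"
    by (intro nth_equalityI) auto
  then show ?thesis by (simp only: block_indices_def length_concat)
qed

text \<open>Positivity of the sizes ensures that every block owns at least one row.\<close>

lemma set_block_indices:
  assumes "\<forall>k \<in> set rs. 0 < k"
  shows "set (block_indices rs) = {..<length rs}"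
proof -
  have "set (block_indices rs) = (\<Union>a<length rs. set (replicate (rs ! a) a))"
    by (auto simp: block_indices_def set_zip)
  then show ?thesis using assms by auto
qed

lemma diag_block_mat_scalars:
  fixes ls :: "'a::semiring_1 list"
  assumes "length ls = length rs"
  shows "diag_block_mat (map2 (\<lambda>l k. l \<cdot>\<^sub>m 1\<^sub>m k) ls rs)
    = mat_diag (sum_list rs) ((!) (concat (map2 (\<lambda>l k. replicate k l) ls rs)))"
  using assms
proof (induction ls rs rule: list_induct2)
  case Nil
  show ?case by (intro eq_matI) (auto simp: mat_diag_def)
next
  case (Cons l ls k rs)
  then show ?case
    by (intro eq_matI) (auto simp: Let_def mat_diag_def four_block_mat_def nth_append)
qed

lemma concat_replicate_eq_map_block_indices:
  assumes "length ls = length rs"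
  shows "concat (map2 (\<lambda>l k. replicate k l) ls rs) = map ((!) ls) (block_indices rs)"
proof -
  have "map2 (\<lambda>l k. replicate k l) ls rs
      = map (map ((!) ls)) (map2 (\<lambda>a k. replicate k a) [0..<length rs] rs)"
    using assms by (intro nth_equalityI) auto
  then show ?thesis by (simp add: block_indices_def map_concat)
qed

text \<open>The scalars form a total function, one value per block, so that products and inverses of
  matrices are taken pointwise.\<close>

definition block_diag :: "nat list \<Rightarrow> (nat \<Rightarrow> 'a::field) \<Rightarrow> 'a mat" where
  "block_diag rs l = mat_diag (sum_list rs) (\<lambda>i. l (block_indices rs ! i))"

lemma block_diag_cong:
  assumes "\<forall>k \<in> set rs. 0 < k" and "\<And>a. a < length rs \<Longrightarrow> l a = l' a"
  shows "block_diag rs l = block_diag rs l'"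
  using assms set_block_indices[OF assms(1)] length_block_indices[of rs] nth_mem[of _ "block_indices rs"]
  by (intro eq_matI) (auto simp: block_diag_def mat_diag_def)

lemma block_scalar_mats_subset:
  assumes "\<forall>k \<in> set rs. 0 < k"
  shows "block_scalar_mats rs \<subseteq> {block_diag rs l | l. \<forall>a. l a \<noteq> 0}"
proof
  fix A assume "A \<in> block_scalar_mats rs"
  then obtain ls where ls: "length ls = length rs" "0 \<notin> set ls"
    and A: "A = diag_block_mat (map2 (\<lambda>l k. l \<cdot>\<^sub>m 1\<^sub>m k) ls rs)"
    by (auto simp: block_scalar_mats_def)
  \<comment> \<open>The default 1 beyond the last block makes the scalars nonzero everywhere and
    leaves the matrix unchanged.\<close>
  let ?l = "\<lambda>a. if a < length rs then ls ! a else 1"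
  have "A = block_diag rs ((!) ls)"
    unfolding A diag_block_mat_scalars[OF ls(1)] concat_replicate_eq_map_block_indices[OF ls(1)]
    by (intro eq_matI) (auto simp: block_diag_def mat_diag_def length_block_indices)
  also have "\<dots> = block_diag rs ?l"
    using assms by (rule block_diag_cong) simp
  finally have "A = block_diag rs ?l" .
  moreover have "\<forall>a. ?l a \<noteq> 0"
    using ls by (metis nth_mem zero_neq_one)
  ultimately show "A \<in> {block_diag rs l | l. \<forall>a. l a \<noteq> 0}" by blast
qed

lemma block_diag_mult: "block_diag rs l * block_diag rs l' = block_diag rs (\<lambda>a. l a * l' a)"
  by (simp add: block_diag_def)

lemma block_diag_one: "block_diag rs (\<lambda>_. 1) = 1\<^sub>m (sum_list rs)"
  by (simp add: block_diag_def)

text \<open>Provides a subgroup containing all admissible generators, hence also the group that they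
  generate.\<close>

lemma subgroup_block_diag:
  "subgroup {block_diag rs l | l. \<forall>a. l a \<noteq> 0} (GL (sum_list rs))" (is "subgroup ?H ?G")
proof -
  interpret group ?G by (rule group_GL)
  have mult: "x \<otimes>\<^bsub>?G\<^esub> y = x * y" and one: "\<one>\<^bsub>?G\<^esub> = 1\<^sub>m (sum_list rs)" for x y
    by (simp_all add: GL_def units_of_mult units_of_one ring_mat_simps)
  have dim: "block_diag rs l \<in> carrier_mat (sum_list rs) (sum_list rs)" for l :: "nat \<Rightarrow> complex"
    by (simp add: block_diag_def)
  have inverse_mult: "block_diag rs (\<lambda>a. inverse (l a)) * block_diag rs l = 1\<^sub>m (sum_list rs)"
    "block_diag rs l * block_diag rs (\<lambda>a. inverse (l a)) = 1\<^sub>m (sum_list rs)"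
    if "\<forall>a. l a \<noteq> 0" for l :: "nat \<Rightarrow> complex"
    using that by (simp_all add: block_diag_mult block_diag_one)
  have sub: "?H \<subseteq> carrier ?G"
    unfolding GL_def units_of_carrier Units_def ring_mat_simps
    using dim inverse_mult by blast
  show ?thesis
  proof (rule subgroupI[OF sub])
    show "?H \<noteq> {}" by (auto intro: exI[of _ "\<lambda>_. 1"])
  next
    fix A assume "A \<in> ?H"
    then obtain l where l: "A = block_diag rs l" "\<forall>a. l a \<noteq> 0" by blast
    then have B: "block_diag rs (\<lambda>a. inverse (l a)) \<in> ?H" by force
    have "inv\<^bsub>?G\<^esub> A = block_diag rs (\<lambda>a. inverse (l a))"
      using inverse_mult(1)[OF l(2)] l(1) \<open>A \<in> ?H\<close> B sub
      by (intro inv_equality) (auto simp: mult one)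
    then show "inv\<^bsub>?G\<^esub> A \<in> ?H" using B by simp
  next
    fix A B assume "A \<in> ?H" "B \<in> ?H"
    then obtain l l' where "A = block_diag rs l" "\<forall>a. l a \<noteq> 0" "B = block_diag rs l'" "\<forall>a. l' a \<noteq> 0"
      by blast
    then show "A \<otimes>\<^bsub>?G\<^esub> B \<in> ?H"
      by (auto simp: mult block_diag_mult intro!: exI[of _ "\<lambda>a. l a * l' a"])
  qed
qed

section \<open>Counting the elements of \<open>N\<close> by their block scalars\<close>

theorem theorem3p5:
  fixes F :: cpoly and d r m :: nat and rs :: "nat list" and N :: "complex mat set"
  assumes "r \<ge> 2" and "d \<ge> 3"
    and "F \<in> polys_in r" and "homogeneous_of_degree d F" and "smooth_poly r F"
    and "1 \<le> m" and "m \<le> r"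
    and "length rs = m" and "\<forall>k \<in> set rs. 0 < k" and "sum_list rs = r"
    and "subgroup N (GL r)" and "N \<subseteq> Aut r F"
    and "comm_group ((GL r)\<lparr>carrier := N\<rparr>)"
    and "\<exists>S \<subseteq> block_scalar_mats rs. N = generate (GL r) S"
  shows "finite N \<and> card N \<le> d ^ m"
proof -
  let ?b = "block_indices rs"
  have set_b: "set ?b = {..<m}" and len_b: "length ?b = r"
    using set_block_indices assms(8-10) length_block_indices by auto
  have "\<exists>i j. i < r \<and> j < r \<and> ?b ! i = a \<and>
      Poly_Mapping.single i (d - 1) + Poly_Mapping.single j 1 \<in> Poly_Mapping.keys F"
    if "a < m" for a
  proof -
    have "a \<in> set ?b" using that set_b by simp
    then obtain i where i: "i < r" "?b ! i = a"
      unfolding in_set_conv_nth len_b by blast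
    obtain j where "j < r"
      "Poly_Mapping.single i (d - 1) + Poly_Mapping.single j 1 \<in> Poly_Mapping.keys F"
      using smooth_poly_monomial[OF assms(3-5) i(1)] .
    then show ?thesis using i by blast
  qed
  then obtain i j where ij: "\<And>a. a < m \<Longrightarrow> i a < r \<and> j a < r \<and> ?b ! i a = a \<and>
      Poly_Mapping.single (i a) (d - 1) + Poly_Mapping.single (j a) 1 \<in> Poly_Mapping.keys F"
    by metis
  \<comment> \<open>The variable \<open>j a\<close> may lie in any block, including
    \<open>a\<close>, so \<open>f\<close> is an arbitrary self-map of the blocks.\<close>
  define f where "f a = ?b ! j a" for a
  let ?S = "power_system (d - 1) f {..<m} :: (nat \<Rightarrow> complex) set"
  have "f a \<in> {..<m}" if "a < m" for a
    using ij[OF that] nth_mem[of "j a" ?b] by (simp add: f_def len_b set_b del: nth_mem)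
  then have f: "f ` {..<m} \<subseteq> {..<m}" by auto
  have d: "d - 1 \<ge> 2" "d - 1 + 1 = d" using assms(2) by auto
  have S_fin: "finite ?S" "card ?S \<le> d ^ m"
    using card_power_system_le[of "{..<m}" f "d - 1", where ?'a = complex] f d by simp_all
  obtain T where T: "T \<subseteq> block_scalar_mats rs" "N = generate (GL r) T"
    using assms(14) by blast
  have N: "N \<subseteq> {block_diag rs l | l. \<forall>a. l a \<noteq> 0}"
    unfolding T(2)
    using group.generate_subgroup_incl[OF group_GL _ subgroup_block_diag] T(1)
      block_scalar_mats_subset[OF assms(9)] assms(10) by blast
  \<comment> \<open>Covering \<open>N\<close> by an image of the solution set suffices, since a map
    does not increase cardinality.\<close>
  have "N \<subseteq> block_diag rs ` ?S"
  proof
    fix A assume A: "A \<in> N"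
    then obtain l where l: "A = block_diag rs l"
      using N by blast
    have "mat_act r A F = F" using A assms(12) by (auto simp: Aut_def)
    then have "mat_act r (mat_diag r (\<lambda>i. l (?b ! i))) F = F"
      using l assms(10) by (simp add: block_diag_def)
    note fixed = mat_diag_fixes_monomial[OF assms(3) this]
    have "l a ^ (d - 1) * l (f a) = 1" if "a < m" for a
      using fixed[of "Poly_Mapping.single (i a) (d - 1) + Poly_Mapping.single (j a) 1"] ij[OF that]
      by (simp only: prod_keys_two_variables f_def)
    \<comment> \<open>Restriction makes the scalars extensional; the matrix only sees the values at
      the \<open>m\<close> blocks.\<close>
    then have "restrict l {..<m} \<in> ?S"
      using f by (auto simp: power_system_def image_subset_iff)
    moreover have "A = block_diag rs (restrict l {..<m})"
      unfolding l using assms(8,9) by (intro block_diag_cong) auto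
    ultimately show "A \<in> block_diag rs ` ?S" by blast
  qed
  then show ?thesis
    using S_fin by (meson card_image_le card_mono finite_imageI finite_subset le_trans)
qed

end
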